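(* Let $\{\varphi_r\}_{0<r<1}\subset L^\infty(\mathbb T)$ be a family of kernels satisfying conditions $\Phi1$, $\Phi4$, $\Phi5$. If a function $\lambda\in C[0,1]$ satisfies $\lambda(1)=0$ and $$\Pi^*=\Pi^*(\lambda,\varphi)=\limsup_{\delta\to0}\liminf_{r\to1}\int_{-\delta\lambda(r)}^{\delta\lambda(r)}\varphi_r(t)\,dt>\frac12,$$ then there exists a measurable set $E\subset\mathbb T$ such that for every $x\in\mathbb T$ $$\limsup_{r\to1}\Phi_r\left(x+\lambda(r),\mathbb I_E\right)-\liminf_{r\to1}\Phi_r\left(x+\lambda(r),\mathbb I_E\right)\ge2\Pi^*-1 .$$
   Context: $\mathbb T=\mathbb R/2\pi\mathbb Z$. The conditions on the kernels are: ($\Phi1$) $\int_{\mathbb T}\varphi_r(t)\,dt\to1$ as $r\to1$; ($\Phi4$) $\varphi_r(x)\ge0$ for $x\in\mathbb T$, $0<r<1$; ($\Phi5$) for any numbers $\gamma>0$ and $0<\tau<1$ there exists $\delta>0$ such that $\int_e\varphi_r(t)\,dt<\gamma$ for all $0<r<\tau$ and every measurable $e\subset\mathbb T$ with $|e|<\delta$. $\Phi_r(x,f):=\int_{\mathbb T}\varphi_r(x-t)f(t)\,dt$, and $\mathbb I_E$ is the indicator function of $E$. In $\Pi^*$, $\delta\to0$ through positive values. $C[0,1]$ consists of real-valued continuous functions. *)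

theory Defs
  imports "HOL-Analysis.Analysis" "HOL-Library.Periodic_Fun"
begin

text \<open>
  The circle \<open>\<real>/2\<pi>\<int>\<close> is rendered by \<open>2\<pi>\<close>-periodic objects on the real line: functions
  on it are \<open>2\<pi>\<close>-periodic functions, its measurable subsets are \<open>2\<pi>\<close>-periodic Lebesgue
  measurable subsets of \<open>\<real>\<close>. Integrals over the circle are integrals over the fundamental
  domain \<open>{-pi..<pi}\<close>. Measurability and integration refer to \<open>lebesgue\<close>, so that functions
  which are Lebesgue but not Borel measurable are included.
\<close>

definition torus_int :: "(real \<Rightarrow> real) \<Rightarrow> real" where
  "torus_int f = set_lebesgue_integral lebesgue {-pi..<pi} f"

definition torus_measurable_set :: "real set \<Rightarrow> bool" where
  "torus_measurable_set E \<longleftrightarrow>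
     E \<in> sets lebesgue \<and> periodic_fun_simple (\<lambda>x. x \<in> E) (2 * pi)"

definition torus_Linf :: "(real \<Rightarrow> real) \<Rightarrow> bool" where
  "torus_Linf f \<longleftrightarrow>
     periodic_fun_simple f (2 * pi) \<and> f \<in> borel_measurable lebesgue \<and>
     (\<exists>B. AE x in lebesgue. \<bar>f x\<bar> \<le> B)"

text \<open>
  A family of kernels is a function \<open>phi\<close> whose first argument is the parameter \<open>r\<close>; only its
  values for \<open>0 < r < 1\<close> matter.
\<close>

definition kernel_Phi1 :: "(real \<Rightarrow> real \<Rightarrow> real) \<Rightarrow> bool" where
  "kernel_Phi1 phi \<longleftrightarrow> ((\<lambda>r. torus_int (phi r)) \<longlongrightarrow> 1) (at_left 1)"

text \<open>
  Elements of \<open>L\<^sup>\<infinity>\<close> are determined only up to null sets, hence the almost-everywhere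
  formulation.
\<close>

definition kernel_Phi4 :: "(real \<Rightarrow> real \<Rightarrow> real) \<Rightarrow> bool" where
  "kernel_Phi4 phi \<longleftrightarrow> (\<forall>r. 0 < r \<and> r < 1 \<longrightarrow> (AE x in lebesgue. 0 \<le> phi r x))"

definition kernel_Phi5 :: "(real \<Rightarrow> real \<Rightarrow> real) \<Rightarrow> bool" where
  "kernel_Phi5 phi \<longleftrightarrow>
     (\<forall>\<gamma> \<tau>. 0 < \<gamma> \<and> 0 < \<tau> \<and> \<tau> < 1 \<longrightarrow>
        (\<exists>\<delta>>0. \<forall>r e. 0 < r \<and> r < \<tau> \<and> e \<in> sets lebesgue \<and> e \<subseteq> {-pi..<pi} \<and>
           measure lebesgue e < \<delta> \<longrightarrow> set_lebesgue_integral lebesgue e (phi r) < \<gamma>))"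

definition Phi_op :: "(real \<Rightarrow> real \<Rightarrow> real) \<Rightarrow> real \<Rightarrow> real \<Rightarrow> (real \<Rightarrow> real) \<Rightarrow> real" where
  "Phi_op phi r x f = torus_int (\<lambda>t. phi r (x - t) * f t)"

text \<open>
  The inner integral is oriented: it is nonpositive wherever \<open>lam r \<le> 0\<close> and \<open>phi r \<ge> 0\<close>.
\<close>

definition Pi_star :: "(real \<Rightarrow> real) \<Rightarrow> (real \<Rightarrow> real \<Rightarrow> real) \<Rightarrow> ereal" where
  "Pi_star lam phi =
     Limsup (at_right 0) (\<lambda>\<delta>. Liminf (at_left 1)
       (\<lambda>r. ereal (LINT t=ereal (- \<delta> * lam r)..ereal (\<delta> * lam r)|lebesgue. phi r t)))"

end

theory Submission
  imports Defs
begin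

text \<open>
  Write \<open>\<Pi>\<close> for \<^const>\<open>Pi_star\<close>. Since the kernels are nonnegative, the mass of \<open>\<phi>\<^sub>r\<close> on
  \<open>(-\<delta>\<lambda>(r), \<delta>\<lambda>(r))\<close> increases with \<open>\<delta>\<close> (and \<open>\<lambda>(r) > 0\<close> near \<open>1\<close>, for otherwise the oriented
  integral would not be positive). Hence the upper limit defining \<open>\<Pi>\<close> is a lower bound that holds for
  \<^emph>\<open>every\<close> \<open>\<delta> > 0\<close>: for \<open>r\<close> near \<open>1\<close>, nearly the mass \<open>\<Pi>\<close> sits within \<open>\<delta>\<lambda>(r)\<close> of the origin
  (\<open>Pi_star_imp_mass\<close>). If a set \<open>S\<close> contains the interval of radius \<open>\<delta>\<lambda>(r)\<close> around \<open>x + \<lambda>(r)\<close>, then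
  \<open>\<Phi>\<^sub>r(x + \<lambda>(r), \<I>\<^sub>S)\<close> is at least nearly \<open>\<Pi>\<close>.

  A very thin set can offer such an interval to all \<open>x\<close> at once. Take the neighbourhood of radius
  \<open>\<eta>a\<close> of the grid \<open>a\<int>\<close>. To the right of \<open>x\<close>, at a distance between \<open>a\<close> and \<open>2a\<close>, lies a grid
  point \<open>c\<close>; as \<open>\<lambda>\<close> is continuous and vanishes at \<open>1\<close>, there is \<open>r\<close> near \<open>1\<close> with
  \<open>x + \<lambda>(r) = c\<close>, and \<open>\<delta> = \<eta>/2\<close> gives \<open>\<delta>\<lambda>(r) \<le> \<eta>a\<close>. Because \<open>\<lambda>(r) \<ge> a\<close>, these \<open>r\<close> stay
  away from \<open>1\<close>, so that uniform absolute continuity of the kernels applies to them: the conclusion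
  survives the removal of any part of the neighbourhood of sufficiently small measure
  (\<open>ex_thin_capturing_set\<close>).

  Choose such neighbourhoods \<open>M\<^sub>0, M\<^sub>1, \<dots>\<close> for errors tending to \<open>0\<close>, each so thin that all later
  ones together are a tolerable perturbation of every earlier one. Let \<open>E\<close> consist of the points for
  which the last \<open>M\<^sub>k\<close> containing them has even index (\<open>ex_alternating_set\<close>). Then \<open>E\<close> nearly
  contains \<open>M\<^sub>k\<close> for even \<open>k\<close>, and its complement nearly contains \<open>M\<^sub>k\<close> for odd \<open>k\<close>. So at every
  \<open>x\<close> both \<open>E\<close> and its complement have upper limit at least \<open>\<Pi>\<close>. As the means of \<open>E\<close> and
  of its complement add up to \<open>\<integral>\<phi>\<^sub>r \<rightarrow> 1\<close>, the lower limit for \<open>E\<close> is at most \<open>1 - \<Pi>\<close>, and the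
  oscillation is at least \<open>2\<Pi> - 1\<close>.
\<close>

section \<open>Integration over the circle\<close>

lemma torus_Linf_set_integrable:
  assumes "torus_Linf f" "A \<in> sets lebesgue" "A \<subseteq> {a..b}"
  shows "set_integrable lebesgue A f"
proof -
  from assms(1) obtain B where f: "f \<in> borel_measurable lebesgue" "AE x in lebesgue. \<bar>f x\<bar> \<le> B"
    by (auto simp: torus_Linf_def)
  have "emeasure lebesgue A \<le> emeasure lebesgue {a..b}"
    using assms by (intro emeasure_mono) auto
  also have "\<dots> < \<infinity>" by (simp add: emeasure_lborel_Icc_eq)
  finally show ?thesis
    unfolding set_integrable_def using assms(2) f
    by (intro integrableI_bounded_set_indicator[where B=B]) auto
qed

lemma lebesgue_isometry_distr:
  assumes "\<bar>c\<bar> = 1"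
  shows "lebesgue = distr lebesgue lebesgue (\<lambda>x::real. t + c * x)"
    and "(\<lambda>x::real. t + c * x) \<in> lebesgue \<rightarrow>\<^sub>M lebesgue"
proof -
  have "c \<noteq> 0" using assms by auto
  then show "lebesgue = distr lebesgue lebesgue (\<lambda>x::real. t + c * x)"
    using lebesgue_real_affine[of c t] assms by (simp add: density_1)
  show "(\<lambda>x::real. t + c * x) \<in> lebesgue \<rightarrow>\<^sub>M lebesgue"
    using lebesgue_affine_measurable[of "\<lambda>_. c" t] \<open>c \<noteq> 0\<close> by simp
qed

lemma set_lebesgue_integral_isometry:
  fixes f :: "real \<Rightarrow> real"
  assumes "\<bar>c\<bar> = 1" "f \<in> borel_measurable lebesgue" "A \<in> sets lebesgue"
  shows "(LINT x:A|lebesgue. f x) = (LINT x:{x. t + c * x \<in> A}|lebesgue. f (t + c * x))"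
proof -
  let ?g = "\<lambda>x. indicat_real A x *\<^sub>R f x"
  have "integral\<^sup>L lebesgue ?g = integral\<^sup>L (distr lebesgue lebesgue (\<lambda>x. t + c * x)) ?g"
    using lebesgue_isometry_distr(1)[OF assms(1), of t] by simp
  also have "\<dots> = integral\<^sup>L lebesgue (\<lambda>x. ?g (t + c * x))"
    using assms lebesgue_isometry_distr(2)[OF assms(1), of t] by (intro integral_distr) auto
  finally show ?thesis
    by (simp add: set_lebesgue_integral_def indicator_def)
qed

text \<open>
  Cut the window at the point \<open>w + 2\<pi>\<close> that it contains, where \<open>w \<in> -\<pi> + 2\<pi>\<int>\<close>, and move the
  right piece back by one period: the two pieces then tile \<open>[w, w + 2\<pi>)\<close>, a translate of the
  fundamental domain by a whole number of periods.
\<close>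

lemma torus_int_window:
  assumes f: "torus_Linf f"
  shows "(LINT x:{u..<u + 2 * pi}|lebesgue. f x) = torus_int f"
proof -
  interpret periodic_fun_simple f "2 * pi" using f by (simp add: torus_Linf_def)
  have meas: "f \<in> borel_measurable lebesgue" using f by (simp add: torus_Linf_def)
  have shift: "(LINT x:{a + of_int m * (2 * pi)..<b + of_int m * (2 * pi)}|lebesgue. f x) = (LINT x:{a..<b}|lebesgue. f x)"
    for a b and m :: int
  proof -
    have "f (of_int m * (2 * pi) + x) = f x" for x
      using plus_of_int[of x m] by (simp add: add.commute)
    moreover have "{x. of_int m * (2 * pi) + 1 * x \<in> {a + of_int m * (2 * pi)..<b + of_int m * (2 * pi)}} = {a..<b}"
      by auto
    ultimately show ?thesis
      using set_lebesgue_integral_isometry[of 1 f "{a + of_int m * (2 * pi)..<b + of_int m * (2 * pi)}" "of_int m * (2 * pi)"] meas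
      by simp
  qed
  have int: "set_integrable lebesgue {a..<b} f" for a b
    by (rule torus_Linf_set_integrable[OF f, of _ a b]) auto
  have split: "(LINT x:{a..<b}|lebesgue. f x) + (LINT x:{b..<c}|lebesgue. f x) = (LINT x:{a..<c}|lebesgue. f x)"
    if "a \<le> b" "b \<le> c" for a b c
  proof -
    have "{a..<c} = {a..<b} \<union> {b..<c}" using that by auto
    then show ?thesis
      using set_integral_Un[OF _ int[of a b] int[of b c]] by auto
  qed
  define m where "m = \<lfloor>(u + pi) / (2 * pi)\<rfloor>"
  define w where "w = - pi + of_int m * (2 * pi)"
  have "of_int m \<le> (u + pi) / (2 * pi)" "(u + pi) / (2 * pi) < of_int m + 1"
    by (auto simp: m_def)
  then have w: "w \<le> u" "u < w + 2 * pi"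
    by (auto simp: w_def field_simps)
  have "(LINT x:{u..<u + 2 * pi}|lebesgue. f x)
      = (LINT x:{u..<w + 2 * pi}|lebesgue. f x) + (LINT x:{w + 2 * pi..<u + 2 * pi}|lebesgue. f x)"
    using w by (simp add: split)
  also have "(LINT x:{w + 2 * pi..<u + 2 * pi}|lebesgue. f x) = (LINT x:{w..<u}|lebesgue. f x)"
    using shift[of w 1 u] by simp
  also have "(LINT x:{u..<w + 2 * pi}|lebesgue. f x) + (LINT x:{w..<u}|lebesgue. f x)
      = (LINT x:{w..<w + 2 * pi}|lebesgue. f x)"
    using w split[of w u "w + 2 * pi"] by simp
  also have "\<dots> = torus_int f"
    using shift[of "-pi" m pi] by (simp add: w_def torus_int_def algebra_simps)
  finally show ?thesis .
qed

lemma torus_int_reflect: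
  assumes f: "torus_Linf f"
  shows "torus_int (\<lambda>s. f (c - s)) = torus_int f"
proof -
  have meas: "f \<in> borel_measurable lebesgue" using f by (simp add: torus_Linf_def)
  have "{x. c + (- 1) * x \<in> {c - pi<..c + pi}} = {- pi..<pi}" by auto
  then have "torus_int (\<lambda>s. f (c - s)) = (LINT x:{c - pi<..c + pi}|lebesgue. f x)"
    using set_lebesgue_integral_isometry[of "-1" f "{c - pi<..c + pi}" c] meas
    by (simp add: torus_int_def)
  \<comment> \<open>The reflected fundamental domain is closed on the other side, which costs two points.\<close>
  also have "\<dots> = (LINT x:{c - pi..<c - pi + 2 * pi}|lebesgue. f x)"
    by (rule set_integral_discrete_difference[where X="{c - pi, c + pi}"]) auto
  also have "\<dots> = torus_int f" by (rule torus_int_window[OF f])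
  finally show ?thesis .
qed

definition arc_measure :: "real set \<Rightarrow> real" where
  "arc_measure A = measure lebesgue (A \<inter> {-pi..<pi})"

lemma torus_measurable_set_iff:
  "torus_measurable_set E \<longleftrightarrow> E \<in> sets lebesgue \<and> (\<forall>x. x + 2 * pi \<in> E \<longleftrightarrow> x \<in> E)"
  by (auto simp: torus_measurable_set_def periodic_fun_simple_def)

lemma torus_measurable_set_Compl:
  "torus_measurable_set E \<Longrightarrow> torus_measurable_set (- E)"
  using sets.compl_sets[of E lebesgue]
  by (auto simp: torus_measurable_set_iff Compl_eq_Diff_UNIV)

lemma torus_measurable_set_Diff:
  "torus_measurable_set E \<Longrightarrow> torus_measurable_set F \<Longrightarrow> torus_measurable_set (E - F)"
  by (auto simp: torus_measurable_set_iff)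

lemma torus_measurable_set_reflect:
  assumes "torus_measurable_set E"
  shows "torus_measurable_set {s. c - s \<in> E}"
proof -
  have "(\<lambda>x. c + (- 1) * x) -` E \<inter> space lebesgue \<in> sets lebesgue"
    using assms lebesgue_isometry_distr(2)[of "-1" c]
    by (intro measurable_sets) (auto simp: torus_measurable_set_iff)
  moreover have "c - (x + 2 * pi) \<in> E \<longleftrightarrow> c - x \<in> E" for x
  proof -
    have "c - (x + 2 * pi) + 2 * pi \<in> E \<longleftrightarrow> c - (x + 2 * pi) \<in> E"
      using assms unfolding torus_measurable_set_iff by blast
    then show ?thesis by (simp add: algebra_simps)
  qed
  ultimately show ?thesis
    by (auto simp: torus_measurable_set_iff vimage_def)
qed

lemma torus_Linf_times_indicator:
  assumes "torus_Linf f" "torus_measurable_set E"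
  shows "torus_Linf (\<lambda>x. f x * indicat_real E x)"
proof -
  from assms(1) obtain B where B: "AE x in lebesgue. \<bar>f x\<bar> \<le> B"
    by (auto simp: torus_Linf_def)
  have "AE x in lebesgue. \<bar>f x * indicat_real E x\<bar> \<le> B"
    using B by eventually_elim (auto simp: indicator_def)
  then have "\<exists>B. AE x in lebesgue. \<bar>f x * indicat_real E x\<bar> \<le> B" ..
  moreover have "periodic_fun_simple (\<lambda>x. f x * indicat_real E x) (2 * pi)"
    using assms unfolding torus_Linf_def torus_measurable_set_iff periodic_fun_simple_def
    by (simp add: indicator_def)
  moreover have "(\<lambda>x. f x * indicat_real E x) \<in> borel_measurable lebesgue"
    using assms unfolding torus_Linf_def torus_measurable_set_iff by auto
  ultimately show ?thesis by (simp add: torus_Linf_def)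
qed

lemma torus_Linf_reflect:
  assumes "torus_Linf f"
  shows "torus_Linf (\<lambda>s. f (c - s))"
proof -
  have T: "lebesgue = distr lebesgue lebesgue (\<lambda>x. c - x)" "(\<lambda>x. c - x) \<in> lebesgue \<rightarrow>\<^sub>M lebesgue"
    using lebesgue_isometry_distr[of "-1" c] by simp_all
  interpret periodic_fun_simple f "2 * pi" using assms by (simp add: torus_Linf_def)
  from assms obtain B where "AE x in lebesgue. \<bar>f x\<bar> \<le> B" by (auto simp: torus_Linf_def)
  then have "AE x in distr lebesgue lebesgue (\<lambda>x. c - x). \<bar>f x\<bar> \<le> B"
    by (subst T(1)[symmetric])
  then have "AE s in lebesgue. \<bar>f (c - s)\<bar> \<le> B"
    by (rule AE_distrD[OF T(2)])
  moreover have "(\<lambda>s. f (c - s)) \<in> borel_measurable lebesgue"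
    using measurable_compose[OF T(2), of f borel] assms by (simp add: torus_Linf_def)
  moreover have "f (c - (s + 2 * pi)) = f (c - s)" for s
    using minus_1[of "c - s"] by (simp add: algebra_simps)
  ultimately show ?thesis
    by (auto simp: torus_Linf_def periodic_fun_simple_def)
qed

lemma arc_measure_eq_torus_int:
  assumes "E \<in> sets lebesgue"
  shows "arc_measure E = torus_int (indicat_real E)"
proof -
  have "(\<lambda>x. indicat_real {-pi..<pi} x *\<^sub>R indicat_real E x) = indicat_real (E \<inter> {-pi..<pi})"
    by (auto simp: indicator_def)
  then show ?thesis
    using assms by (simp add: arc_measure_def torus_int_def set_lebesgue_integral_def)
qed

lemma arc_measure_reflect:
  assumes "torus_measurable_set E"
  shows "arc_measure {s. c - s \<in> E} = arc_measure E"
proof -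
  have "torus_Linf (\<lambda>x::real. 1 :: real)"
    by (auto simp: torus_Linf_def periodic_fun_simple_def)
  then have "torus_Linf (indicat_real E)"
    using torus_Linf_times_indicator[OF _ assms] by force
  moreover have "indicat_real {s. c - s \<in> E} = (\<lambda>s. indicat_real E (c - s))"
    by (auto simp: indicator_def)
  ultimately show ?thesis
    using assms torus_measurable_set_reflect[OF assms, of c] torus_int_reflect[of "indicat_real E" c]
    by (simp add: arc_measure_eq_torus_int torus_measurable_set_iff)
qed

lemma arc_measure_mono:
  assumes "A \<subseteq> B" "A \<in> sets lebesgue" "B \<in> sets lebesgue"
  shows "arc_measure A \<le> arc_measure B"
  unfolding arc_measure_def
proof (rule measure_mono_fmeasurable)
  have "{-pi..<pi} \<in> lmeasurable" by (auto intro: bounded_set_imp_lmeasurable)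
  then show "B \<inter> {-pi..<pi} \<in> lmeasurable" using assms(3) by (metis fmeasurable_Int_fmeasurable Int_commute)
qed (use assms in auto)

lemma arc_measure_UN_le:
  assumes "\<And>i. A i \<in> sets lebesgue" "summable (\<lambda>i. arc_measure (A i))"
  shows "arc_measure (\<Union>i::nat. A i) \<le> (\<Sum>i. arc_measure (A i))"
proof -
  have T: "{-pi..<pi} \<in> lmeasurable" by (auto intro: bounded_set_imp_lmeasurable)
  then have "A i \<inter> {-pi..<pi} \<in> lmeasurable" for i
    using assms(1) by (metis fmeasurable_Int_fmeasurable Int_commute)
  then have "emeasure lebesgue (A i \<inter> {-pi..<pi}) = ennreal (arc_measure (A i))" for i
    unfolding arc_measure_def by (intro emeasure_eq_measure2) 
  then have "measure lebesgue (\<Union>i. A i \<inter> {-pi..<pi}) \<le> (\<Sum>i. measure lebesgue (A i \<inter> {-pi..<pi}))"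
    using assms
    by (intro measure_subadditive_countably) (auto simp: ennreal_suminf_neq_top arc_measure_def)
  then show ?thesis by (simp add: arc_measure_def)
qed


section \<open>Capturing the mass of the kernel\<close>

text \<open>
  After the substitution \<open>t = c - s\<close>, the mass of \<open>f\<close> on \<open>(-h, h)\<close> is seen by \<open>E\<close> except where
  \<open>c - s\<close> lies in the part of \<open>M\<close> that \<open>E\<close> misses. Keeping the loss as an integral over that
  part leaves it to be estimated by absolute continuity.
\<close>

lemma kernel_mass_captured:
  assumes f: "torus_Linf f" and nonneg: "AE x in lebesgue. 0 \<le> f x"
    and E: "torus_measurable_set E" and M: "torus_measurable_set M" and "h \<le> pi"
    and near: "\<And>s. \<bar>s\<bar> < h \<Longrightarrow> c - s \<in> M"
  shows "(LINT s:{-h<..<h}|lebesgue. f s)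
    \<le> torus_int (\<lambda>t. f (c - t) * indicat_real E t)
      + (LINT s:{-h<..<h} \<inter> {s. c - s \<in> M - E}|lebesgue. f s)"
proof -
  let ?E = "{s. c - s \<in> E}" and ?D = "{-h<..<h} \<inter> {s. c - s \<in> M - E}" and ?T = "{-pi..<pi}"
  have tE: "torus_measurable_set ?E" by (rule torus_measurable_set_reflect[OF E])
  have tD: "torus_measurable_set {s. c - s \<in> M - E}"
    by (intro torus_measurable_set_reflect torus_measurable_set_Diff E M)
  then have D: "?D \<in> sets lebesgue" by (auto simp: torus_measurable_set_iff)
  have g: "torus_Linf (\<lambda>s. f s * indicat_real ?E s)"
    by (rule torus_Linf_times_indicator[OF f tE])
  have "torus_int (\<lambda>t. f (c - t) * indicat_real E t) = torus_int (\<lambda>s. f s * indicat_real ?E s)"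
    using torus_int_reflect[OF g, of c] by (simp add: indicator_def)
  moreover have "(LINT s:{-h<..<h}|lebesgue. f s)
      \<le> torus_int (\<lambda>s. f s * indicat_real ?E s) + (LINT s:?D|lebesgue. f s)"
  proof -
    have i1: "set_integrable lebesgue {-h<..<h} f"
      by (rule torus_Linf_set_integrable[OF f, of _ "-h" h]) auto
    have i2: "set_integrable lebesgue ?T (\<lambda>s. f s * indicat_real ?E s)"
      by (rule torus_Linf_set_integrable[OF g, of _ "-pi" pi]) auto
    have i3: "set_integrable lebesgue ?D f"
      by (rule torus_Linf_set_integrable[OF f D, of "-h" h]) auto
    have "AE s in lebesgue. indicat_real {-h<..<h} s *\<^sub>R f s
        \<le> indicat_real ?T s *\<^sub>R (f s * indicat_real ?E s) + indicat_real ?D s *\<^sub>R f s"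
      using nonneg
    proof eventually_elim
      case (elim s)
      show ?case
      proof (cases "\<bar>s\<bar> < h")
        case True
        then have "c - s \<in> M" "s \<in> ?T" "s \<in> {-h<..<h}" using near \<open>h \<le> pi\<close> by auto
        then show ?thesis using elim by (cases "c - s \<in> E") (auto simp: indicator_def)
      next
        case False
        then have "s \<notin> {-h<..<h}" by auto
        then show ?thesis using elim by (auto simp: indicator_def)
      qed
    qed
    then have "(LINT s:{-h<..<h}|lebesgue. f s)
        \<le> (\<integral>s. indicat_real ?T s *\<^sub>R (f s * indicat_real ?E s) + indicat_real ?D s *\<^sub>R f s \<partial>lebesgue)"
      using i1 i2 i3 unfolding set_lebesgue_integral_def set_integrable_def
      by (intro integral_mono_AE Bochner_Integration.integrable_add)
    also have "\<dots> = torus_int (\<lambda>s. f s * indicat_real ?E s) + (LINT s:?D|lebesgue. f s)"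
      using i2 i3 unfolding set_lebesgue_integral_def torus_int_def set_integrable_def
      by (rule Bochner_Integration.integral_add)
    finally show ?thesis .
  qed
  ultimately show ?thesis by simp
qed

text \<open>
  The measure bound depends only on the ratio of radius and mesh, so that the mesh can be refined
  at will without enlarging the set. The mesh divides \<open>2\<pi>\<close> to make the set periodic.
\<close>

lemma grid_neighbourhood:
  assumes "0 < N" "0 < \<eta>" "\<eta> \<le> 1" and a: "a = 2 * pi / real N"
  defines "S \<equiv> {t. \<exists>j::int. \<bar>t - of_int j * a\<bar> < \<eta> * a}"
  shows "torus_measurable_set S" and "arc_measure S \<le> 12 * pi * \<eta>"
proof -
  have "a > 0" and Na: "real N * a = 2 * pi" using assms by auto
  have "S = (\<Union>j::int. ball (of_int j * a) (\<eta> * a))"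
    by (auto simp: S_def dist_real_def abs_minus_commute)
  then have "open S" by auto
  then have S: "S \<in> sets lebesgue" by auto
  have "x + 2 * pi \<in> S \<longleftrightarrow> x \<in> S" for x
  proof -
    have "\<bar>x + 2 * pi - of_int j * a\<bar> = \<bar>x - of_int (j - int N) * a\<bar>" for j :: int
      using Na by (simp add: algebra_simps)
    then have "x + 2 * pi \<in> S \<longleftrightarrow> (\<exists>j. \<bar>x - of_int (j - int N) * a\<bar> < \<eta> * a)"
      by (simp add: S_def)
    also have "\<dots> \<longleftrightarrow> (\<exists>j. \<bar>x - of_int j * a\<bar> < \<eta> * a)"
      by (metis add_diff_cancel_right')
    finally show ?thesis by (simp add: S_def)
  qed
  with S show "torus_measurable_set S" by (auto simp: torus_measurable_set_iff)

  let ?I = "\<lambda>j::int. {of_int j * a - \<eta> * a<..<of_int j * a + \<eta> * a}"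
  have sub: "S \<inter> {-pi..<pi} \<subseteq> (\<Union>j\<in>{-int N..int N}. ?I j)"
  proof
    fix t assume t: "t \<in> S \<inter> {-pi..<pi}"
    then obtain j :: int where j: "\<bar>t - of_int j * a\<bar> < \<eta> * a" by (auto simp: S_def)
    have "\<eta> * a \<le> a" using \<open>a > 0\<close> \<open>\<eta> \<le> 1\<close> by simp
    then have "\<bar>of_int j * a\<bar> < pi + a" using j t by auto
    also have "\<dots> \<le> (real N + 1) * a" using Na \<open>a > 0\<close> pi_gt_zero by (simp add: algebra_simps)
    finally have "\<bar>of_int j\<bar> < real N + 1" using \<open>a > 0\<close> by (simp add: abs_mult)
    then have "j \<in> {-int N..int N}" by auto
    then show "t \<in> (\<Union>j\<in>{-int N..int N}. ?I j)" using j by (auto intro!: bexI[of _ j])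
  qed
  have "arc_measure S \<le> measure lebesgue (\<Union>j\<in>{-int N..int N}. ?I j)"
    unfolding arc_measure_def using S
    by (intro measure_mono_fmeasurable[OF sub] fmeasurable.finite_UN) auto
  also have "\<dots> \<le> (\<Sum>j\<in>{-int N..int N}. measure lebesgue (?I j))"
    by (intro measure_UNION_le) auto
  also have "\<dots> = (2 * real N + 1) * (2 * \<eta> * a)"
    using \<open>a > 0\<close> \<open>\<eta> > 0\<close> by simp
  also have "\<dots> \<le> (3 * real N) * (2 * \<eta> * a)"
    using \<open>a > 0\<close> \<open>\<eta> > 0\<close> \<open>N > 0\<close> by (intro mult_right_mono) auto
  also have "\<dots> = 6 * \<eta> * (real N * a)" by simp
  also have "\<dots> = 12 * pi * \<eta>" by (simp add: Na)
  finally show "arc_measure S \<le> 12 * pi * \<eta>" .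
qed

text \<open>
  The distance \<open>\<epsilon>\<close> of \<open>r\<close> from \<open>1\<close> is part of the notion so that the property for all small
  \<open>\<epsilon>\<close> is a statement about upper limits at \<open>1\<close>.
\<close>

definition captures_mass ::
    "(real \<Rightarrow> real \<Rightarrow> real) \<Rightarrow> (real \<Rightarrow> real) \<Rightarrow> real \<Rightarrow> real \<Rightarrow> real set \<Rightarrow> bool" where
  "captures_mass phi lam \<epsilon> p S \<longleftrightarrow>
     (\<forall>x. \<exists>r. 1 - \<epsilon> < r \<and> 0 < r \<and> r < 1 \<and> p < Phi_op phi r (x + lam r) (indicat_real S))"

lemma tendsto_at_left_endpoint:
  fixes f :: "real \<Rightarrow> real"
  assumes "continuous_on {0..1} f"
  shows "(f \<longlongrightarrow> f 1) (at_left 1)"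
proof -
  have "(f \<longlongrightarrow> f 1) (at 1 within {0..1})"
    using assms by (auto simp: continuous_on_def)
  then show ?thesis by (simp add: at_within_Icc_at_left)
qed

text \<open>
  The order of choices matters. The thinness \<open>\<eta>\<close> is fixed first and determines \<open>\<delta>\<close>; then the
  mesh \<open>a\<close> is taken so small that all values of \<open>\<lambda>\<close> in \<open>[a, 2a]\<close> are attained close to \<open>1\<close>.
  These values are not attained beyond some \<open>\<tau> < 1\<close>, and the tolerance \<open>d\<close> comes from the absolute
  continuity of the kernels with \<open>r < \<tau>\<close>. The set \<open>S\<close> is quantified last because the
  final set is known only when all later grids have been chosen.
\<close>

lemma ex_thin_capturing_set:
  assumes Linf: "\<And>r. 0 < r \<Longrightarrow> r < 1 \<Longrightarrow> torus_Linf (phi r)"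
    and nonneg: "kernel_Phi4 phi" and ac: "kernel_Phi5 phi"
    and cont: "continuous_on {0..1} lam" and "lam 1 = 0"
    and pos: "\<forall>\<^sub>F r in at_left 1. 0 < lam r"
    and mass: "\<And>\<delta>. 0 < \<delta> \<Longrightarrow>
      \<forall>\<^sub>F r in at_left 1. p < (LINT t:{-(\<delta> * lam r)<..<\<delta> * lam r}|lebesgue. phi r t)"
    and "0 < D" "0 < \<epsilon>"
  shows "\<exists>M d. torus_measurable_set M \<and> arc_measure M \<le> D \<and> 0 < d \<and>
    (\<forall>S. torus_measurable_set S \<and> arc_measure (M - S) < d \<longrightarrow> captures_mass phi lam \<epsilon> (p - \<epsilon>) S)"
proof -
  define \<eta> where "\<eta> = min (D / (12 * pi)) 1"
  have \<eta>: "0 < \<eta>" "\<eta> \<le> 1" "12 * pi * \<eta> \<le> D"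
    using \<open>0 < D\<close> by (auto simp: \<eta>_def min_def field_simps)
  define \<delta> where "\<delta> = \<eta> / 2"
  have "0 < \<delta>" using \<eta> by (simp add: \<delta>_def)
  have "\<forall>\<^sub>F r in at_left 1. 0 < lam r \<and>
      p < (LINT t:{-(\<delta> * lam r)<..<\<delta> * lam r}|lebesgue. phi r t)"
    by (intro eventually_conj pos mass \<open>0 < \<delta>\<close>)
  then obtain b where "b < 1" and b: "\<And>r. b < r \<Longrightarrow> r < 1 \<Longrightarrow> 0 < lam r \<and>
      p < (LINT t:{-(\<delta> * lam r)<..<\<delta> * lam r}|lebesgue. phi r t)"
    by (auto simp: eventually_at_left_field)
  define \<rho> where "\<rho> = (1 + max b (max 0 (1 - \<epsilon>))) / 2"
  have \<rho>: "b < \<rho>" "0 < \<rho>" "1 - \<epsilon> < \<rho>" "\<rho> < 1"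
    using \<open>b < 1\<close> \<open>0 < \<epsilon>\<close> by (auto simp: \<rho>_def)
  have "0 < lam \<rho>" using b \<rho> by simp
  define K where "K = min (lam \<rho>) 1"
  have K: "0 < K" "K \<le> lam \<rho>" "K \<le> 1" using \<open>0 < lam \<rho>\<close> by (auto simp: K_def)
  obtain N :: nat where N: "4 * pi / K < real N" using reals_Archimedean2 by blast
  have "0 < 4 * pi / K" using K by simp
  then have "0 < N" using N by (cases N) auto
  define a where "a = 2 * pi / real N"
  have a: "0 < a" "2 * a < K"
    using N \<open>0 < N\<close> K by (auto simp: a_def field_simps)
  have "\<forall>\<^sub>F r in at_left 1. lam r < a"
    using tendsto_at_left_endpoint[OF cont] \<open>lam 1 = 0\<close> a by (auto dest: order_tendstoD)
  then obtain \<tau>' where "\<tau>' < 1" and \<tau>': "\<And>r. \<tau>' < r \<Longrightarrow> r < 1 \<Longrightarrow> lam r < a"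
    by (auto simp: eventually_at_left_field)
  define \<tau> where "\<tau> = (1 + max \<tau>' 0) / 2"
  have \<tau>: "\<tau>' < \<tau>" "0 < \<tau>" "\<tau> < 1" using \<open>\<tau>' < 1\<close> by (auto simp: \<tau>_def)
  obtain d where "0 < d" and d: "\<And>r e. \<lbrakk>0 < r; r < \<tau>; e \<in> sets lebesgue; e \<subseteq> {-pi..<pi};
      measure lebesgue e < d\<rbrakk> \<Longrightarrow> (LINT t:e|lebesgue. phi r t) < \<epsilon>"
    using ac \<tau> \<open>0 < \<epsilon>\<close> unfolding kernel_Phi5_def by metis
  define M where "M = {t. \<exists>j::int. \<bar>t - of_int j * a\<bar> < \<eta> * a}"
  have M: "torus_measurable_set M" "arc_measure M \<le> 12 * pi * \<eta>"
    using grid_neighbourhood[OF \<open>0 < N\<close> \<eta>(1,2) a_def] by (simp_all add: M_def)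
  have "captures_mass phi lam \<epsilon> (p - \<epsilon>) S"
    if S: "torus_measurable_set S" "arc_measure (M - S) < d" for S
    unfolding captures_mass_def
  proof
    fix x
    \<comment> \<open>The next grid point but one: the nearest one may be too close to \<open>x\<close>, which would let
      \<open>r\<close> approach \<open>1\<close>.\<close>
    define j where "j = \<lceil>x / a\<rceil> + 1"
    define c where "c = of_int j * a"
    have "x / a + 1 \<le> of_int j" "of_int j < x / a + 2" by (auto simp: j_def) linarith+
    then have c: "a \<le> c - x" "c - x \<le> 2 * a"
      using a by (auto simp: c_def field_simps)
    have "continuous_on {\<rho>..1} lam"
      using cont by (rule continuous_on_subset) (use \<rho> in auto)
    then obtain r where r: "\<rho> \<le> r" "r \<le> 1" "lam r = c - x"
      using IVT2'[of lam 1 "c - x" \<rho>] c a K \<rho> \<open>lam 1 = 0\<close> by auto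
    have "r \<noteq> 1" using r c a \<open>lam 1 = 0\<close> by auto
    then have "r < 1" using r by simp
    have "r < \<tau>" using \<tau>'[of r] \<tau> c r \<open>r < 1\<close> by (cases "r < \<tau>") auto
    define h where "h = \<delta> * lam r"
    have "h \<le> \<delta> * (2 * a)" unfolding h_def using r c \<open>0 < \<delta>\<close> by (intro mult_left_mono) auto
    then have h: "h \<le> \<eta> * a" by (simp add: \<delta>_def)
    also have "\<dots> \<le> 1 * pi"
      using \<eta> a K pi_gt3 by (intro mult_mono) auto
    finally have "h \<le> pi" by simp
    have near: "c - s \<in> M" if "\<bar>s\<bar> < h" for s
      using that h by (auto simp: M_def c_def intro!: exI[of _ j])
    have r0: "0 < r" using r \<rho> by simp
    let ?R = "{s. c - s \<in> M - S}"
    have R: "torus_measurable_set ?R"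
      by (intro torus_measurable_set_reflect torus_measurable_set_Diff M S)
    let ?e = "{-h<..<h} \<inter> ?R"
    have e: "?e \<in> sets lebesgue" using R by (auto simp: torus_measurable_set_iff)
    have "?e \<inter> {-pi..<pi} = ?e" using \<open>h \<le> pi\<close> by auto
    then have "measure lebesgue ?e = arc_measure ?e" by (simp only: arc_measure_def)
    also have "\<dots> \<le> arc_measure ?R"
      using e R by (intro arc_measure_mono) (auto simp: torus_measurable_set_iff)
    also have "\<dots> = arc_measure (M - S)"
      by (intro arc_measure_reflect torus_measurable_set_Diff M S)
    also have "\<dots> < d" by fact
    finally have "(LINT s:?e|lebesgue. phi r s) < \<epsilon>"
      using e \<open>?e \<inter> {-pi..<pi} = ?e\<close> by (intro d r0 \<open>r < \<tau>\<close>) auto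
    moreover have "(LINT s:{-h<..<h}|lebesgue. phi r s)
      \<le> torus_int (\<lambda>t. phi r (c - t) * indicat_real S t) + (LINT s:?e|lebesgue. phi r s)"
      using nonneg r0 \<open>r < 1\<close> near \<open>h \<le> pi\<close>
      by (intro kernel_mass_captured Linf S M) (auto simp: kernel_Phi4_def)
    moreover have "p < (LINT s:{-h<..<h}|lebesgue. phi r s)"
      using b[of r] r \<rho> \<open>r < 1\<close> by (simp add: h_def)
    ultimately have "p - \<epsilon> < Phi_op phi r (x + lam r) (indicat_real S)"
      using r by (simp add: Phi_op_def)
    then show "\<exists>r. 1 - \<epsilon> < r \<and> 0 < r \<and> r < 1 \<and> p - \<epsilon> < Phi_op phi r (x + lam r) (indicat_real S)"
      using r \<rho> r0 \<open>r < 1\<close> by (intro exI[of _ r]) auto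
  qed
  then show ?thesis
    using M \<eta> \<open>0 < d\<close> by (intro exI[of _ M] exI[of _ d]) auto
qed

section \<open>Following a sequence of thin sets alternately\<close>

text \<open>
  The witness consists of the points whose last \<open>M k\<close> has even index. A point of \<open>M k\<close> that lies in no
  later member is therefore placed on the side prescribed by the parity of \<open>k\<close>, so the part
  of \<open>M k\<close> on the wrong side is covered by the later members. Their measures are
  dominated by \<open>d k / 4\<close>, \<open>d k / 8\<close>, ..., with sum \<open>d k / 2\<close>.
\<close>

lemma ex_alternating_set:
  fixes d :: "nat \<Rightarrow> real"
  assumes M: "\<And>k. torus_measurable_set (M k)"
    and small: "\<And>k. arc_measure (M (Suc k)) \<le> d k / 4"
    and d: "\<And>k. 0 < d k" "\<And>k. d (Suc k) \<le> d k / 2"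
  shows "\<exists>E. torus_measurable_set E \<and>
    (\<forall>k. arc_measure (M k - (if even k then E else - E)) < d k)"
proof -
  define E where "E = (\<Union>k\<in>{k. even k}. M k - (\<Union>j\<in>{k<..}. M j))"
  have Ms: "M k \<in> sets lebesgue" for k using M by (auto simp: torus_measurable_set_iff)
  have "E \<in> sets lebesgue"
    unfolding E_def using Ms by (intro sets.countable_UN' sets.Diff) auto
  moreover have "x + 2 * pi \<in> E \<longleftrightarrow> x \<in> E" for x
    using M by (simp add: E_def torus_measurable_set_iff)
  ultimately have E: "torus_measurable_set E" by (auto simp: torus_measurable_set_iff)
  have "arc_measure (M k - (if even k then E else - E)) < d k" for k
  proof -
    let ?A = "\<lambda>i. M (Suc (k + i))"
    have "M k - (if even k then E else - E) \<subseteq> (\<Union>i. ?A i)"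
    proof
      fix t assume t: "t \<in> M k - (if even k then E else - E)"
      show "t \<in> (\<Union>i. ?A i)"
      proof (rule ccontr)
        assume "t \<notin> (\<Union>i. ?A i)"
        then have later: "t \<notin> M j" if "k < j" for j
          using less_imp_Suc_add[OF that] by auto
        show False
        proof (cases "even k")
          case True
          with t later have "t \<in> E" by (auto simp: E_def)
          with t True show False by simp
        next
          case False
          with t obtain l where l: "even l" "t \<in> M l" "\<And>j. l < j \<Longrightarrow> t \<notin> M j"
            by (auto simp: E_def)
          have "l \<noteq> k" using l(1) False by auto
          then show False
            using later[of l] l(2) l(3)[of k] t by (cases "l < k") auto
        qed
      qed
    qed
    then have "arc_measure (M k - (if even k then E else - E)) \<le> arc_measure (\<Union>i. ?A i)"
      using Ms E torus_measurable_set_Compl[OF E]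
      by (intro arc_measure_mono) (auto simp: torus_measurable_set_iff)
    have dk: "d (k + i) \<le> d k * (1/2) ^ i" for i
      using d(2)[of "k + i" for i] by (induction i) (auto intro: order_trans)
    have bound: "arc_measure (?A i) \<le> d k / 4 * (1/2) ^ i" for i
    proof -
      have "arc_measure (?A i) \<le> d (k + i) / 4" using small[of "k + i"] by simp
      also have "\<dots> \<le> d k * (1/2) ^ i / 4" using dk[of i] by (rule divide_right_mono) simp
      finally show ?thesis by simp
    qed
    have sums: "(\<lambda>i. d k / 4 * (1/2) ^ i) sums (d k / 4 * 2)"
      using sums_mult[OF geometric_sums[of "1/2::real"], of "d k / 4"] by simp
    have nn: "0 \<le> arc_measure A" for A by (simp add: arc_measure_def)
    have summ: "summable (\<lambda>i. arc_measure (?A i))"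
      using bound nn by (intro summable_comparison_test'[OF sums_summable[OF sums]]) auto
    have "arc_measure (\<Union>i. ?A i) \<le> (\<Sum>i. arc_measure (?A i))"
      using Ms summ by (rule arc_measure_UN_le)
    also have "\<dots> \<le> (\<Sum>i. d k / 4 * (1/2) ^ i)"
      using bound summ sums_summable[OF sums] by (intro suminf_le) auto
    also have "\<dots> = d k / 2" using sums_unique[OF sums] by simp
    also have "\<dots> < d k" using d(1)[of k] by simp
    finally show ?thesis
      using \<open>arc_measure (M k - (if even k then E else - E)) \<le> arc_measure (\<Union>i. ?A i)\<close> by simp
  qed
  with E show ?thesis by blast
qed

section \<open>The limiting mass\<close>

lemma symmetric_interval_mass_mono:
  assumes "torus_Linf f" "AE x in lebesgue. 0 \<le> f x"
  shows "h \<le> k \<Longrightarrow> (LINT t:{-h<..<h}|lebesgue. f t) \<le> (LINT t:{-k<..<k}|lebesgue. f t)"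
    and "k \<le> pi \<Longrightarrow> (LINT t:{-k<..<k}|lebesgue. f t) \<le> torus_int f"
proof -
  have *: "(LINT t:A|lebesgue. f t) \<le> (LINT t:B|lebesgue. f t)"
    if "A \<subseteq> B" "A \<in> sets lebesgue" "B \<in> sets lebesgue" "B \<subseteq> {a..b}" for A B a b
  proof -
    have "set_integrable lebesgue A f" "set_integrable lebesgue B f"
      using that by (auto intro!: torus_Linf_set_integrable[OF assms(1), of _ a b])
    moreover have "AE t in lebesgue. indicat_real A t *\<^sub>R f t \<le> indicat_real B t *\<^sub>R f t"
      using assms(2) by eventually_elim (use that in \<open>auto simp: indicator_def\<close>)
    ultimately show ?thesis
      unfolding set_integrable_def set_lebesgue_integral_def by (intro integral_mono_AE)
  qed
  show "(LINT t:{-h<..<h}|lebesgue. f t) \<le> (LINT t:{-k<..<k}|lebesgue. f t)" if "h \<le> k"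
    by (rule *[of _ _ "-k" k]) (use that in auto)
  show "(LINT t:{-k<..<k}|lebesgue. f t) \<le> torus_int f" if "k \<le> pi"
    unfolding torus_int_def by (rule *[of _ _ "-pi" pi]) (use that in auto)
qed


lemma eventually_in_unit_interval: "\<forall>\<^sub>F r in at_left (1::real). 0 < r \<and> r < 1"
  using eventually_at_left_field[of _ "1::real"] by (auto intro: exI[of _ 0])

lemma oriented_interval_integral:
  fixes f :: "real \<Rightarrow> real"
  assumes "AE x in lebesgue. 0 \<le> f x"
  shows "0 \<le> h \<Longrightarrow> (LINT t=ereal (-h)..ereal h|lebesgue. f t) = (LINT t:{-h<..<h}|lebesgue. f t)"
    and "h \<le> 0 \<Longrightarrow> (LINT t=ereal (-h)..ereal h|lebesgue. f t) \<le> 0"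
proof -
  have "0 \<le> (LINT t:A|lebesgue. f t)" for A
  proof -
    have "AE t in lebesgue. 0 \<le> indicat_real A t *\<^sub>R f t"
      using assms by eventually_elim simp
    then show ?thesis unfolding set_lebesgue_integral_def by (rule integral_nonneg_AE)
  qed
  then show "0 \<le> h \<Longrightarrow> (LINT t=ereal (-h)..ereal h|lebesgue. f t) = (LINT t:{-h<..<h}|lebesgue. f t)"
    and "h \<le> 0 \<Longrightarrow> (LINT t=ereal (-h)..ereal h|lebesgue. f t) \<le> 0"
    by (auto simp: interval_lebesgue_integral_def set_lebesgue_integral_def)
qed

text \<open>
  An upper limit above \<open>p\<close> only provides arbitrarily small \<open>\<delta>'\<close>. Monotonicity in the
  width of the interval then passes from \<open>\<delta>'\<close> to any larger \<open>\<delta>\<close> (\<open>Pi_star_imp_mass\<close> below).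
\<close>

lemma less_Pi_star_imp_eventually:
  assumes "ereal p < Pi_star lam phi" "0 < \<delta>"
  obtains \<delta>' where "0 < \<delta>'" "\<delta>' < \<delta>"
    "\<forall>\<^sub>F r in at_left 1. p < (LINT t=ereal (- (\<delta>' * lam r))..ereal (\<delta>' * lam r)|lebesgue. phi r t)"
proof -
  let ?I = "\<lambda>\<delta> r. LINT t=ereal (- \<delta> * lam r)..ereal (\<delta> * lam r)|lebesgue. phi r t"
  have "\<exists>\<delta>'. 0 < \<delta>' \<and> \<delta>' < \<delta> \<and> ereal p < Liminf (at_left 1) (\<lambda>r. ereal (?I \<delta>' r))"
  proof (rule ccontr)
    assume "\<not> ?thesis"
    then have "\<forall>\<^sub>F \<delta>' in at_right 0. Liminf (at_left 1) (\<lambda>r. ereal (?I \<delta>' r)) \<le> ereal p"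
      using \<open>0 < \<delta>\<close> unfolding eventually_at_right_field by (meson not_less)
    then have "Pi_star lam phi \<le> ereal p"
      unfolding Pi_star_def by (rule Limsup_bounded)
    with assms show False by simp
  qed
  then show ?thesis using that by (auto dest!: less_LiminfD)
qed

text \<open>
  For a nonnegative kernel the oriented integral is nonpositive where \<open>\<lambda>(r) \<le> 0\<close>, so a positive
  lower limit of these integrals rules out \<open>\<lambda>(r) \<le> 0\<close> near \<open>1\<close>.
\<close>

lemma Pi_star_imp_eventually_pos:
  assumes "kernel_Phi4 phi" "0 < Pi_star lam phi"
  shows "\<forall>\<^sub>F r in at_left 1. 0 < lam r"
proof -
  obtain \<delta> where "0 < \<delta>"
    and mass: "\<forall>\<^sub>F r in at_left 1. 0 < (LINT t=ereal (- (\<delta> * lam r))..ereal (\<delta> * lam r)|lebesgue. phi r t)"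
    using less_Pi_star_imp_eventually[of 0 lam phi 1] assms(2) by (auto simp: zero_ereal_def)
  from mass show ?thesis
    using eventually_in_unit_interval
  proof (eventually_elim)
    case (elim r)
    then have nn: "AE x in lebesgue. 0 \<le> phi r x" using assms(1) by (simp add: kernel_Phi4_def)
    show ?case
    proof (rule ccontr)
      assume "\<not> 0 < lam r"
      then have "\<delta> * lam r \<le> 0" using \<open>0 < \<delta>\<close> by (simp add: mult_le_0_iff)
      from oriented_interval_integral(2)[OF nn this] elim show False by simp
    qed
  qed
qed

lemma Pi_star_imp_mass:
  assumes "\<And>r. 0 < r \<Longrightarrow> r < 1 \<Longrightarrow> torus_Linf (phi r)" "kernel_Phi4 phi"
    and "0 < Pi_star lam phi" "ereal p < Pi_star lam phi" "0 < \<delta>"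
  shows "\<forall>\<^sub>F r in at_left 1. p < (LINT t:{-(\<delta> * lam r)<..<\<delta> * lam r}|lebesgue. phi r t)"
proof -
  obtain \<delta>' where \<delta>': "0 < \<delta>'" "\<delta>' < \<delta>"
    and mass: "\<forall>\<^sub>F r in at_left 1. p < (LINT t=ereal (- (\<delta>' * lam r))..ereal (\<delta>' * lam r)|lebesgue. phi r t)"
    using less_Pi_star_imp_eventually assms(4,5) by blast
  from mass show ?thesis
    using eventually_in_unit_interval Pi_star_imp_eventually_pos[OF assms(2,3)]
  proof (eventually_elim)
    case (elim r)
    then have nn: "AE x in lebesgue. 0 \<le> phi r x" using assms(2) by (simp add: kernel_Phi4_def)
    have "p < (LINT t:{-(\<delta>' * lam r)<..<\<delta>' * lam r}|lebesgue. phi r t)"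
      using elim oriented_interval_integral(1)[OF nn, of "\<delta>' * lam r"] \<delta>' by simp
    also have "\<dots> \<le> (LINT t:{-(\<delta> * lam r)<..<\<delta> * lam r}|lebesgue. phi r t)"
      using elim \<delta>' assms(1) nn by (intro symmetric_interval_mass_mono(1)) auto
    finally show ?case .
  qed
qed

text \<open>
  Once \<open>\<lambda>(r) < \<pi>\<close>, the interval \<open>(-\<lambda>(r), \<lambda>(r))\<close> fits into one period, where the total mass tends
  to \<open>1\<close>. This makes \<open>Pi_star\<close> a real number.
\<close>

lemma Pi_star_le_1:
  assumes "\<And>r. 0 < r \<Longrightarrow> r < 1 \<Longrightarrow> torus_Linf (phi r)" "kernel_Phi1 phi" "kernel_Phi4 phi"
    and "continuous_on {0..1} lam" "lam 1 = 0"
  shows "Pi_star lam phi \<le> 1"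
proof (rule ccontr)
  assume "\<not> ?thesis"
  then have "1 < Pi_star lam phi" by simp
  then obtain p where p: "1 < ereal p" "ereal p < Pi_star lam phi" using ereal_dense2 by blast
  have "0 < Pi_star lam phi" using \<open>1 < Pi_star lam phi\<close> by (rule less_trans[rotated]) simp
  have "\<forall>\<^sub>F r in at_left 1. lam r < pi"
    using order_tendstoD(2)[OF tendsto_at_left_endpoint[OF assms(4)], of pi] assms(5) by simp
  moreover have "\<forall>\<^sub>F r in at_left 1. torus_int (phi r) < p"
    using assms(2) p by (auto simp: kernel_Phi1_def dest: order_tendstoD)
  moreover have "\<forall>\<^sub>F r in at_left 1. p < (LINT t:{-(1 * lam r)<..<1 * lam r}|lebesgue. phi r t)"
    by (rule Pi_star_imp_mass) (use assms(1,3) p \<open>0 < Pi_star lam phi\<close> in auto)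
  moreover note eventually_in_unit_interval
  ultimately have "\<forall>\<^sub>F r in at_left (1::real). False"
  proof eventually_elim
    case (elim r)
    then have nn: "AE x in lebesgue. 0 \<le> phi r x" using assms(3) by (simp add: kernel_Phi4_def)
    have "(LINT t:{-(1 * lam r)<..<1 * lam r}|lebesgue. phi r t) \<le> torus_int (phi r)"
      using elim assms(1) nn by (intro symmetric_interval_mass_mono(2)) auto
    then show False using elim by simp
  qed
  then show False by simp
qed

section \<open>The divergence set\<close>

lemma Phi_op_Compl:
  assumes "torus_Linf (phi r)" "torus_measurable_set E"
  shows "Phi_op phi r x (indicat_real E) + Phi_op phi r x (indicat_real (- E)) = torus_int (phi r)"
proof -
  have *: "set_integrable lebesgue {-pi..<pi} (\<lambda>t. phi r (x - t) * indicat_real A t)"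
    if "torus_measurable_set A" for A
    using torus_Linf_times_indicator[OF torus_Linf_reflect[OF assms(1)] that]
    by (rule torus_Linf_set_integrable[of _ _ "-pi" pi]) auto
  have "torus_int (phi r) = torus_int (\<lambda>t. phi r (x - t))"
    by (rule torus_int_reflect[OF assms(1), symmetric])
  also have "\<dots> = torus_int (\<lambda>t. phi r (x - t) * indicat_real E t + phi r (x - t) * indicat_real (- E) t)"
    by (intro arg_cong[of _ _ torus_int]) (auto simp: indicator_def)
  also have "\<dots> = Phi_op phi r x (indicat_real E) + Phi_op phi r x (indicat_real (- E))"
    unfolding Phi_op_def torus_int_def
    by (intro set_integral_add * assms torus_measurable_set_Compl)
  finally show ?thesis by simp
qed

text \<open>
  With \<open>\<epsilon>\<close> controlling both the position of \<open>r\<close> and the loss of mass, letting it tend to \<open>0\<close> gives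
  parameters tending to \<open>1\<close> along which the means approach \<open>p\<close>.
\<close>

lemma captures_mass_imp_Limsup:
  assumes "\<And>\<epsilon>. 0 < \<epsilon> \<Longrightarrow> captures_mass phi lam \<epsilon> (p - \<epsilon>) S"
  shows "ereal p \<le> Limsup (at_left 1) (\<lambda>r. ereal (Phi_op phi r (x + lam r) (indicat_real S)))"
proof (rule ccontr)
  assume "\<not> ?thesis"
  then obtain q where q: "Limsup (at_left 1) (\<lambda>r. ereal (Phi_op phi r (x + lam r) (indicat_real S))) < ereal q"
    "q < p"
    using ereal_dense2[of _ "ereal p"] by (auto simp: not_le)
  then have "\<forall>\<^sub>F r in at_left 1. Phi_op phi r (x + lam r) (indicat_real S) < q"
    by (auto dest: Limsup_lessD)
  then obtain b where b: "b < 1" "\<And>r. b < r \<Longrightarrow> r < 1 \<Longrightarrow> Phi_op phi r (x + lam r) (indicat_real S) < q"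
    by (auto simp: eventually_at_left_field)
  define \<epsilon> where "\<epsilon> = min (1 - b) (p - q)"
  have "0 < \<epsilon>" "\<epsilon> \<le> 1 - b" "\<epsilon> \<le> p - q" using b q by (auto simp: \<epsilon>_def)
  with assms[of \<epsilon>] obtain r where "1 - \<epsilon> < r" "r < 1" "p - \<epsilon> < Phi_op phi r (x + lam r) (indicat_real S)"
    unfolding captures_mass_def by blast
  with b(2)[of r] \<open>\<epsilon> \<le> 1 - b\<close> \<open>\<epsilon> \<le> p - q\<close> show False by simp
qed

lemma captures_mass_mono:
  "captures_mass phi lam \<epsilon> p S \<Longrightarrow> \<epsilon> \<le> \<epsilon>' \<Longrightarrow> p' \<le> p \<Longrightarrow> captures_mass phi lam \<epsilon>' p' S"
  unfolding captures_mass_def by (smt (verit))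

theorem theorem2p1:
  fixes phi :: "real \<Rightarrow> real \<Rightarrow> real" and lam :: "real \<Rightarrow> real"
  assumes "\<And>r. 0 < r \<Longrightarrow> r < 1 \<Longrightarrow> torus_Linf (phi r)"
    and "kernel_Phi1 phi" and "kernel_Phi4 phi" and "kernel_Phi5 phi"
    and "continuous_on {0..1} lam" and "lam 1 = 0"
    and "Pi_star lam phi > 1 / 2"
  shows "\<exists>E. torus_measurable_set E \<and>
    (\<forall>x. Limsup (at_left 1) (\<lambda>r. ereal (Phi_op phi r (x + lam r) (indicat_real E)))
       - Liminf (at_left 1) (\<lambda>r. ereal (Phi_op phi r (x + lam r) (indicat_real E)))
       \<ge> 2 * Pi_star lam phi - 1)"
proof -
  have half_pos: "(0::ereal) < 1 / 2" by (simp add: one_ereal_def)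
  then have Pi_pos: "0 < Pi_star lam phi" using assms(7) by (rule less_trans)
  have "Pi_star lam phi \<le> 1" by (rule Pi_star_le_1[OF assms(1-3,5,6)])
  then obtain P where P: "Pi_star lam phi = ereal P"
    using Pi_pos by (cases "Pi_star lam phi") auto
  have step: "\<exists>M d. torus_measurable_set M \<and> arc_measure M \<le> D \<and> 0 < d \<and> d \<le> D' \<and>
    (\<forall>S. torus_measurable_set S \<and> arc_measure (M - S) < d \<longrightarrow> captures_mass phi lam \<epsilon> (P - 2 * \<epsilon>) S)"
    if "0 < D" "0 < D'" "0 < \<epsilon>" for D D' \<epsilon>
  proof -
    have "ereal (P - \<epsilon>) < Pi_star lam phi" using P that by simp
    note Pi_star_imp_mass[OF assms(1,3) Pi_pos this]
    from ex_thin_capturing_set[OF assms(1,3-6) Pi_star_imp_eventually_pos[OF assms(3) Pi_pos] this \<open>0 < D\<close> \<open>0 < \<epsilon>\<close>]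
    obtain M d where "torus_measurable_set M" "arc_measure M \<le> D" "0 < d"
      "\<And>S. torus_measurable_set S \<Longrightarrow> arc_measure (M - S) < d \<Longrightarrow> captures_mass phi lam \<epsilon> (P - \<epsilon> - \<epsilon>) S"
      by blast
    with \<open>0 < D'\<close> show ?thesis
      by (intro exI[of _ M] exI[of _ "min d D'"]) (auto simp: algebra_simps)
  qed
  \<comment> \<open>A pair \<open>(M, d)\<close> is good at stage \<open>k\<close> if every set containing \<open>M\<close> up to measure \<open>d\<close> captures
    mass with error \<open>1 / (k + 1)\<close>. Shrinking \<open>d\<close> preserves this, which makes the decay of \<open>d\<close> available.\<close>
  define good where "good k Md \<longleftrightarrow> (case Md of (M, d) \<Rightarrow> torus_measurable_set M \<and> 0 < d \<and>
      (\<forall>S. torus_measurable_set S \<and> arc_measure (M - S) < d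
         \<longrightarrow> captures_mass phi lam (1 / Suc k) (P - 2 * (1 / Suc k)) S))" for k :: nat and Md
  have "\<exists>f. \<forall>k. good k (f k) \<and>
      (arc_measure (fst (f (Suc k))) \<le> snd (f k) / 4 \<and> snd (f (Suc k)) \<le> snd (f k) / 2)"
  proof (rule dependent_nat_choice)
    show "\<exists>Md. good 0 Md"
      using step[of 1 1 "1 / Suc 0"] by (auto simp: good_def)
    show "\<exists>Md'. good (Suc k) Md' \<and> (arc_measure (fst Md') \<le> snd Md / 4 \<and> snd Md' \<le> snd Md / 2)"
      if "good k Md" for Md k
      using step[of "snd Md / 4" "snd Md / 2" "1 / Suc (Suc k)"] that
      by (auto simp: good_def split: prod.splits)
  qed
  then obtain f where good: "\<And>k. good k (f k)"
    and f: "\<And>k. arc_measure (fst (f (Suc k))) \<le> snd (f k) / 4" "\<And>k. snd (f (Suc k)) \<le> snd (f k) / 2"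
    by blast
  have "torus_measurable_set (fst (f k))" "0 < snd (f k)" for k
    using good[of k] by (auto simp: good_def split: prod.splits)
  from ex_alternating_set[of "\<lambda>k. fst (f k)" "\<lambda>k. snd (f k)", OF this(1) f(1) this(2) f(2)]
  obtain E where E: "torus_measurable_set E"
    and close: "\<And>k. arc_measure (fst (f k) - (if even k then E else - E)) < snd (f k)" by blast
  note E' = torus_measurable_set_Compl[OF E]
  have captures: "captures_mass phi lam (1 / Suc k) (P - 2 * (1 / Suc k)) (if even k then E else - E)" for k
    using good[of k] close[of k] E E' by (auto simp: good_def split: prod.splits)
  have "captures_mass phi lam \<epsilon> (P - \<epsilon>) E \<and> captures_mass phi lam \<epsilon> (P - \<epsilon>) (- E)" if "0 < \<epsilon>" for \<epsilon>
  proof -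
    obtain n :: nat where n: "2 / \<epsilon> < real n" using reals_Archimedean2 by blast
    have "captures_mass phi lam \<epsilon> (P - \<epsilon>) (if even k then E else - E)" if "n \<le> k" for k
    proof -
      have "2 / \<epsilon> < real (Suc k)" using n that by simp
      then have "2 * (1 / Suc k) < \<epsilon>" using \<open>0 < \<epsilon>\<close> by (simp add: field_simps)
      then show ?thesis
        using \<open>0 < \<epsilon>\<close> by (intro captures_mass_mono[OF captures[of k]]) (auto simp: field_simps)
    qed
    \<comment> \<open>One index of each parity serves \<open>E\<close> and its complement.\<close>
    from this[of "2 * n"] this[of "Suc (2 * n)"] show ?thesis by simp
  qed
  then have capE: "\<And>\<epsilon>. 0 < \<epsilon> \<Longrightarrow> captures_mass phi lam \<epsilon> (P - \<epsilon>) E"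
    and capE': "\<And>\<epsilon>. 0 < \<epsilon> \<Longrightarrow> captures_mass phi lam \<epsilon> (P - \<epsilon>) (- E)" by auto
  have "2 * Pi_star lam phi - 1
    \<le> Limsup (at_left 1) (\<lambda>r. ereal (Phi_op phi r (x + lam r) (indicat_real E)))
      - Liminf (at_left 1) (\<lambda>r. ereal (Phi_op phi r (x + lam r) (indicat_real E)))" for x
  proof -
    let ?F = "\<lambda>S r. Phi_op phi r (x + lam r) (indicat_real S)"
    have up: "ereal P \<le> Limsup (at_left 1) (\<lambda>r. ereal (?F E r))"
      by (rule captures_mass_imp_Limsup[OF capE])
    \<comment> \<open>A larger lower limit for \<open>E\<close> would keep the means of the complement below \<open>P\<close>
      by a fixed margin, as the two means add up to the total mass.\<close>
    have "Liminf (at_left 1) (\<lambda>r. ereal (?F E r)) \<le> ereal (1 - P)"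
    proof (rule ccontr)
      assume "\<not> ?thesis"
      then obtain q where q: "1 - P < q" "ereal q < Liminf (at_left 1) (\<lambda>r. ereal (?F E r))"
        using ereal_dense2[of "ereal (1 - P)"] by (auto simp: not_le)
      define \<eta> where "\<eta> = (q - (1 - P)) / 2"
      have "\<forall>\<^sub>F r in at_left 1. q < ?F E r" using q(2) by (auto dest: less_LiminfD)
      moreover have "\<forall>\<^sub>F r in at_left 1. torus_int (phi r) < 1 + \<eta>"
        using assms(2) q(1) unfolding kernel_Phi1_def
        by (intro order_tendstoD(2)[of _ 1]) (auto simp: \<eta>_def)
      ultimately have "\<forall>\<^sub>F r in at_left 1. ereal (?F (- E) r) \<le> ereal (P - \<eta>)"
        using eventually_in_unit_interval
      proof eventually_elim
        case (elim r)
        then show ?case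
          using Phi_op_Compl[of phi r E "x + lam r", OF assms(1) E] by (simp add: \<eta>_def field_simps)
      qed
      then have "Limsup (at_left 1) (\<lambda>r. ereal (?F (- E) r)) \<le> ereal (P - \<eta>)"
        by (rule Limsup_bounded)
      with captures_mass_imp_Limsup[OF capE', of x] have "ereal P \<le> ereal (P - \<eta>)"
        by (rule order_trans)
      then show False using q(1) by (simp add: \<eta>_def)
    qed
    with up have "ereal P - ereal (1 - P) \<le> Limsup (at_left 1) (\<lambda>r. ereal (?F E r))
      - Liminf (at_left 1) (\<lambda>r. ereal (?F E r))"
      by (rule ereal_minus_mono)
    moreover have "2 * Pi_star lam phi - 1 = ereal P - ereal (1 - P)"
      by (simp add: P one_ereal_def)
    ultimately show ?thesis by simp
  qed
  with E show ?thesis by blast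
qed

end
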